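(* Let $G$ be a finite group acting transitively on a finite set $\Omega$. Let $d_H$ be a positive number such that any non-trivial irreducible component of the corresponding permutation representation has degree at least $d_H$. Let $S$ be a subset of $G$ and $\Delta_1,\Delta_2$ subsets of $\Omega$ such that $|S||\Delta_1||\Delta_2|\geq |\Omega|^2|G|/d_H$. Then there exist $g\in S$, $\omega_1\in\Delta_1$ and $\omega_2\in\Delta_2$ such that $g(\omega_1)=\omega_2$.
   Context: The permutation representation corresponding to the action of $G$ on $\Omega$ is the complex representation of $G$ on the vector space with basis $\Omega$ obtained by linearly extending the action; with $H$ the stabilizer of a point it is also denoted $1_H^G$. *)

theory Defs
  imports Complex_Main "HOL-Library.Function_Algebras" "HOL-Algebra.Group_Action"
begin

text \<open>
  A representation of a group \<open>G\<close> on a subspace \<open>V\<close> of an ambient vector space is given by a family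
  of maps \<open>\<rho> g\<close> of which only the restrictions to \<open>V\<close> for \<open>g\<close> in the carrier of \<open>G\<close> matter.
\<close>

locale rep_space = vector_space scale
  for scale :: "'a::field \<Rightarrow> 'b::ab_group_add \<Rightarrow> 'b"
begin

definition group_rep :: "('g, 'm) monoid_scheme \<Rightarrow> ('g \<Rightarrow> 'b \<Rightarrow> 'b) \<Rightarrow> 'b set \<Rightarrow> bool" where
  "group_rep G \<rho> V \<longleftrightarrow>
     subspace V \<and>
     (\<forall>g\<in>carrier G. \<forall>v\<in>V. \<rho> g v \<in> V) \<and>
     (\<forall>g\<in>carrier G. \<forall>v\<in>V. \<forall>w\<in>V. \<rho> g (v + w) = \<rho> g v + \<rho> g w) \<and>
     (\<forall>g\<in>carrier G. \<forall>c. \<forall>v\<in>V. \<rho> g (scale c v) = scale c (\<rho> g v)) \<and>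
     (\<forall>v\<in>V. \<rho> \<one>\<^bsub>G\<^esub> v = v) \<and>
     (\<forall>g\<in>carrier G. \<forall>h\<in>carrier G. \<forall>v\<in>V. \<rho> (g \<otimes>\<^bsub>G\<^esub> h) v = \<rho> g (\<rho> h v))"

definition subrep :: "('g, 'm) monoid_scheme \<Rightarrow> ('g \<Rightarrow> 'b \<Rightarrow> 'b) \<Rightarrow> 'b set \<Rightarrow> 'b set \<Rightarrow> bool" where
  "subrep G \<rho> V W \<longleftrightarrow> W \<subseteq> V \<and> subspace W \<and> (\<forall>g\<in>carrier G. \<forall>w\<in>W. \<rho> g w \<in> W)"

definition irreducible_rep :: "('g, 'm) monoid_scheme \<Rightarrow> ('g \<Rightarrow> 'b \<Rightarrow> 'b) \<Rightarrow> 'b set \<Rightarrow> bool" where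
  "irreducible_rep G \<rho> V \<longleftrightarrow>
     group_rep G \<rho> V \<and> V \<noteq> {0} \<and> (\<forall>W. subrep G \<rho> V W \<longrightarrow> W = {0} \<or> W = V)"

definition trivial_rep :: "('g, 'm) monoid_scheme \<Rightarrow> ('g \<Rightarrow> 'b \<Rightarrow> 'b) \<Rightarrow> 'b set \<Rightarrow> bool" where
  "trivial_rep G \<rho> V \<longleftrightarrow> group_rep G \<rho> V \<and> dim V = 1 \<and> (\<forall>g\<in>carrier G. \<forall>v\<in>V. \<rho> g v = v)"

text \<open>
  For complex representations of finite groups every irreducible constituent is isomorphic to an
  irreducible subrepresentation (complete reducibility), so components are taken to be subspaces.
\<close>

definition irreducible_component ::
  "('g, 'm) monoid_scheme \<Rightarrow> ('g \<Rightarrow> 'b \<Rightarrow> 'b) \<Rightarrow> 'b set \<Rightarrow> 'b set \<Rightarrow> bool" where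
  "irreducible_component G \<rho> V W \<longleftrightarrow> subrep G \<rho> V W \<and> irreducible_rep G \<rho> W"

end

definition cfun_scale :: "complex \<Rightarrow> ('w \<Rightarrow> complex) \<Rightarrow> 'w \<Rightarrow> complex" where
  "cfun_scale c f = (\<lambda>x. c * f x)"

global_interpretation cfun: rep_space "cfun_scale :: complex \<Rightarrow> ('w \<Rightarrow> complex) \<Rightarrow> 'w \<Rightarrow> complex"
  by unfold_locales (auto simp: cfun_scale_def fun_eq_iff algebra_simps)

text \<open>
  The vector space with basis \<open>\<Omega>\<close>: a formal combination of points of \<open>\<Omega>\<close> is encoded by its
  coefficient function, and the point \<open>\<omega>\<close> by \<open>point_vec \<omega>\<close>.  For finite \<open>\<Omega>\<close> these are all the
  functions vanishing outside \<open>\<Omega>\<close>.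
\<close>

definition point_vec :: "'w \<Rightarrow> 'w \<Rightarrow> complex" where
  "point_vec \<omega> = (\<lambda>x. if x = \<omega> then 1 else 0)"

definition perm_space :: "'w set \<Rightarrow> ('w \<Rightarrow> complex) set" where
  "perm_space \<Omega> = cfun.span (point_vec ` \<Omega>)"

definition perm_rep :: "'w set \<Rightarrow> ('g \<Rightarrow> 'w \<Rightarrow> 'w) \<Rightarrow> 'g \<Rightarrow> ('w \<Rightarrow> complex) \<Rightarrow> 'w \<Rightarrow> complex" where
  "perm_rep \<Omega> \<phi> g f = (\<Sum>\<omega>\<in>\<Omega>. cfun_scale (f \<omega>) (point_vec (\<phi> g \<omega>)))"

lemma sum_cfun_apply: "(\<Sum>i\<in>A. F i) x = (\<Sum>i\<in>A. (F i x :: complex))"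
  by (induction A rule: infinite_finite_induct) auto

lemma perm_space_eq:
  assumes "finite \<Omega>"
  shows "perm_space \<Omega> = {f. \<forall>x. x \<notin> \<Omega> \<longrightarrow> f x = 0}"
proof
  have "cfun.subspace {f. \<forall>x. x \<notin> \<Omega> \<longrightarrow> f x = 0}"
    by (auto simp: cfun.subspace_def cfun_scale_def)
  then show "perm_space \<Omega> \<subseteq> {f. \<forall>x. x \<notin> \<Omega> \<longrightarrow> f x = 0}"
    unfolding perm_space_def by (intro cfun.span_minimal) (auto simp: point_vec_def)
  show "{f. \<forall>x. x \<notin> \<Omega> \<longrightarrow> f x = 0} \<subseteq> perm_space \<Omega>"
  proof
    fix f :: "'a \<Rightarrow> complex" assume f: "f \<in> {f. \<forall>x. x \<notin> \<Omega> \<longrightarrow> f x = 0}"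
    have "f = (\<Sum>\<omega>\<in>\<Omega>. cfun_scale (f \<omega>) (point_vec \<omega>))"
      using f assms by (auto simp: fun_eq_iff sum_cfun_apply cfun_scale_def point_vec_def if_distrib cong: if_cong)
    also have "\<dots> \<in> perm_space \<Omega>"
      unfolding perm_space_def
      by (intro cfun.span_sum cfun.span_scale cfun.span_base) auto
    finally show "f \<in> perm_space \<Omega>" .
  qed
qed

lemma independent_point_vec: "cfun.independent (point_vec ` \<Omega>)"
proof -
  have "point_vec \<omega> \<notin> cfun.span (point_vec ` \<Omega> - {point_vec \<omega>})" for \<omega> :: 'a
  proof
    assume *: "point_vec \<omega> \<in> cfun.span (point_vec ` \<Omega> - {point_vec \<omega>})"
    have "cfun.subspace {f. f \<omega> = 0}"
      by (auto simp: cfun.subspace_def cfun_scale_def)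
    then have "cfun.span (point_vec ` \<Omega> - {point_vec \<omega>}) \<subseteq> {f. f \<omega> = 0}"
      by (intro cfun.span_minimal) (auto simp: point_vec_def)
    with * show False by (auto simp: point_vec_def)
  qed
  then show ?thesis by (auto simp: cfun.dependent_def)
qed

lemma perm_rep_point_vec:
  assumes "finite \<Omega>" "\<omega> \<in> \<Omega>"
  shows "perm_rep \<Omega> \<phi> g (point_vec \<omega>) = point_vec (\<phi> g \<omega>)"
  using assms
  by (auto simp: perm_rep_def fun_eq_iff sum_cfun_apply cfun_scale_def point_vec_def[of \<omega>]
      if_distrib[of "\<lambda>c. c * _"] cong: if_cong)

lemma group_rep_perm_rep:
  assumes "group_action G \<Omega> \<phi>" "finite \<Omega>"
  shows "cfun.group_rep G (perm_rep \<Omega> \<phi>) (perm_space \<Omega>)"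
proof -
  interpret group_action G \<Omega> \<phi> by fact
  have add: "perm_rep \<Omega> \<phi> g (v + w) = perm_rep \<Omega> \<phi> g v + perm_rep \<Omega> \<phi> g w" for g v w
    by (simp add: perm_rep_def cfun.scale_left_distrib sum.distrib)
  have scale: "perm_rep \<Omega> \<phi> g (cfun_scale c v) = cfun_scale c (perm_rep \<Omega> \<phi> g v)" for g c v
    by (auto simp: perm_rep_def fun_eq_iff sum_cfun_apply cfun_scale_def sum_distrib_left mult.assoc)
  have lin: "module_hom cfun_scale cfun_scale (perm_rep \<Omega> \<phi> g)" for g
    by unfold_locales (simp_all add: add scale)
  have act: "\<phi> g \<omega> \<in> \<Omega>" if "g \<in> carrier G" "\<omega> \<in> \<Omega>" for g \<omega>
    using element_image[OF that refl] .
  have closed: "perm_rep \<Omega> \<phi> g v \<in> perm_space \<Omega>" if "g \<in> carrier G" for g v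
    unfolding perm_rep_def perm_space_def using that
    by (intro cfun.span_sum cfun.span_scale cfun.span_base) (auto simp: act)
  have "perm_rep \<Omega> \<phi> \<one>\<^bsub>G\<^esub> v = v" if "v \<in> perm_space \<Omega>" for v
  proof -
    have "\<phi> \<one>\<^bsub>G\<^esub> \<omega> = \<omega>" if "\<omega> \<in> \<Omega>" for \<omega>
      using that by (simp flip: id_eq_one)
    then show ?thesis
      using that assms(2)
      by (auto simp: perm_space_eq perm_rep_def fun_eq_iff sum_cfun_apply cfun_scale_def
          point_vec_def if_distrib cong: if_cong)
  qed
  moreover have "perm_rep \<Omega> \<phi> (g \<otimes>\<^bsub>G\<^esub> h) v = perm_rep \<Omega> \<phi> g (perm_rep \<Omega> \<phi> h v)"
    if "g \<in> carrier G" "h \<in> carrier G" for g h v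
  proof -
    interpret L: module_hom cfun_scale cfun_scale "perm_rep \<Omega> \<phi> g" by (rule lin)
    have "perm_rep \<Omega> \<phi> g (perm_rep \<Omega> \<phi> h v)
        = (\<Sum>\<omega>\<in>\<Omega>. cfun_scale (v \<omega>) (perm_rep \<Omega> \<phi> g (point_vec (\<phi> h \<omega>))))"
      unfolding perm_rep_def[of \<Omega> \<phi> h] by (simp add: L.sum L.scale)
    also have "\<dots> = (\<Sum>\<omega>\<in>\<Omega>. cfun_scale (v \<omega>) (point_vec (\<phi> g (\<phi> h \<omega>))))"
      using that assms(2) by (intro sum.cong refl) (simp add: perm_rep_point_vec act)
    also have "\<dots> = perm_rep \<Omega> \<phi> (g \<otimes>\<^bsub>G\<^esub> h) v"
      using that unfolding perm_rep_def by (intro sum.cong refl) (simp add: composition_rule)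
    finally show ?thesis by simp
  qed
  ultimately show ?thesis
    unfolding cfun.group_rep_def by (auto simp: add scale closed) (simp add: perm_space_def)
qed

end

theory Submission
  imports Defs "HOL-Analysis.Function_Topology" "HOL-Analysis.Topology_Euclidean_Space"
begin

text \<open>
  For \<open>f\<close> in the permutation module put \<open>Q v = (\<Sum>g\<in>G. \<bar>\<langle>v, g f\<rangle>\<bar>\<^sup>2)\<close>, a \<open>G\<close>-invariant positive
  semidefinite form, and let \<open>\<lambda>\<close> be its maximum on the unit sphere of the sum-zero functions. There
  \<open>\<lambda> \<langle>v, v\<rangle> - Q v\<close> is positive semidefinite, so its null vectors form a nonzero submodule; this
  contains an irreducible component \<open>W\<close>, which is nontrivial because fixed vectors are constant by
  transitivity. Summing \<open>Q\<close> over an orthonormal basis of \<open>W\<close> and applying Bessel's inequality to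
  each \<open>g f\<close> gives \<open>\<lambda> dim W \<le> |G| \<langle>f, f\<rangle>\<close>, hence \<open>\<lambda> \<le> |G| \<langle>f, f\<rangle> / d\<close>.

  If no \<open>g \<in> S\<close> maps a point of \<open>\<Delta>\<^sub>1\<close> into \<open>\<Delta>\<^sub>2\<close>, then the centred indicators \<open>f\<^sub>i\<close> of \<open>\<Delta>\<^sub>i\<close> satisfy
  \<open>\<langle>f\<^sub>2, g f\<^sub>1\<rangle> = - |\<Delta>\<^sub>1| |\<Delta>\<^sub>2| / |\<Omega>|\<close> for all \<open>g \<in> S\<close>. The bound on \<open>Q f\<^sub>2\<close> for \<open>f = f\<^sub>1\<close>, together with
  \<open>\<langle>f\<^sub>i, f\<^sub>i\<rangle> = |\<Delta>\<^sub>i| (1 - |\<Delta>\<^sub>i| / |\<Omega>|)\<close>, then contradicts the hypothesis; the factors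
  \<open>1 - |\<Delta>\<^sub>i| / |\<Omega>| < 1\<close> account for the non-strict inequality in it.
\<close>

section \<open>Hermitian form, Bessel's inequality and orthonormal families\<close>

definition inner_on :: "'w set \<Rightarrow> ('w \<Rightarrow> complex) \<Rightarrow> ('w \<Rightarrow> complex) \<Rightarrow> complex" where
  "inner_on A u v = (\<Sum>x\<in>A. u x * cnj (v x))"

definition sqnorm_on :: "'w set \<Rightarrow> ('w \<Rightarrow> complex) \<Rightarrow> real" where
  "sqnorm_on A u = (\<Sum>x\<in>A. (cmod (u x))\<^sup>2)"

definition orthonormal_on :: "'w set \<Rightarrow> ('w \<Rightarrow> complex) set \<Rightarrow> bool" where
  "orthonormal_on A B \<longleftrightarrow> (\<forall>b\<in>B. \<forall>c\<in>B. inner_on A b c = of_bool (b = c))"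

lemma inner_on_add_left: "inner_on A (u + v) w = inner_on A u w + inner_on A v w"
  by (simp add: inner_on_def sum.distrib algebra_simps)

lemma inner_on_diff_left: "inner_on A (u - v) w = inner_on A u w - inner_on A v w"
  by (simp add: inner_on_def sum_subtractf algebra_simps)

lemma inner_on_scale_left: "inner_on A (cfun_scale c u) w = c * inner_on A u w"
  by (simp add: inner_on_def cfun_scale_def sum_distrib_left mult.assoc)

lemma inner_on_sum_left: "inner_on A (\<Sum>i\<in>I. F i) w = (\<Sum>i\<in>I. inner_on A (F i) w)"
  by (simp add: inner_on_def sum_cfun_apply sum_distrib_right sum.swap[of _ A])

lemma cnj_inner_on: "cnj (inner_on A u v) = inner_on A v u"
  by (simp add: inner_on_def mult.commute)

lemma inner_on_diff_right: "inner_on A u (v - w) = inner_on A u v - inner_on A u w"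
  by (simp add: inner_on_def sum_subtractf algebra_simps)

lemma inner_on_scale_right: "inner_on A u (cfun_scale c w) = cnj c * inner_on A u w"
  by (simp add: inner_on_def cfun_scale_def sum_distrib_left algebra_simps)

lemma inner_on_sum_right: "inner_on A u (\<Sum>i\<in>I. F i) = (\<Sum>i\<in>I. inner_on A u (F i))"
  by (simp add: inner_on_def sum_cfun_apply sum_distrib_left sum.swap[of _ A])

lemma inner_on_self: "inner_on A u u = complex_of_real (sqnorm_on A u)"
  by (simp add: inner_on_def sqnorm_on_def flip: complex_norm_square)

lemma sqnorm_on_nonneg: "0 \<le> sqnorm_on A u"
  by (simp add: sqnorm_on_def sum_nonneg)

lemma sqnorm_on_scale: "sqnorm_on A (cfun_scale c u) = (cmod c)\<^sup>2 * sqnorm_on A u"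
  by (simp add: sqnorm_on_def cfun_scale_def norm_mult power_mult_distrib sum_distrib_left)

lemma cmod_parallelogram:
  "(cmod (a + b))\<^sup>2 + (cmod (a - b))\<^sup>2 = 2 * (cmod a)\<^sup>2 + 2 * (cmod b)\<^sup>2"
  unfolding cmod_power2 by (simp add: power2_eq_square algebra_simps)

text \<open>Together with the same identity for \<open>coeff_energy\<close>, this later shows that
  the vectors attaining the maximal ratio are closed under addition, without any need for
  polarisation.\<close>

lemma sqnorm_on_parallelogram:
  "sqnorm_on A (u + v) + sqnorm_on A (u - v) = 2 * sqnorm_on A u + 2 * sqnorm_on A v"
  by (simp add: sqnorm_on_def sum_distrib_left cmod_parallelogram flip: sum.distrib)

lemma sqnorm_on_eq_0_iff:
  assumes "finite A" "u \<in> perm_space A"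
  shows "sqnorm_on A u = 0 \<longleftrightarrow> u = 0"
  using assms by (auto simp: sqnorm_on_def perm_space_eq sum_nonneg_eq_0_iff fun_eq_iff)

lemma inner_on_orthonormal_sum:
  assumes "finite B" "orthonormal_on A B" "b \<in> B"
  shows "inner_on A (\<Sum>c\<in>B. cfun_scale (a c) c) b = a b"
proof -
  have "inner_on A (\<Sum>c\<in>B. cfun_scale (a c) c) b = (\<Sum>c\<in>B. a c * of_bool (c = b))"
    unfolding inner_on_sum_left inner_on_scale_left
    using assms(2,3) by (intro sum.cong refl) (simp add: orthonormal_on_def)
  then show ?thesis
    using assms by simp
qed

text \<open>With \<open>p\<close> the orthogonal projection of \<open>x\<close> to the span of
  \<open>B\<close>, the difference of the two sides is the squared norm of
  \<open>x - p\<close>.\<close>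

lemma bessel_on:
  assumes "finite B" "orthonormal_on A B"
  shows "(\<Sum>b\<in>B. (cmod (inner_on A b x))\<^sup>2) \<le> sqnorm_on A x"
proof -
  define p where "p = (\<Sum>b\<in>B. cfun_scale (inner_on A x b) b)"
  have pb: "inner_on A p b = inner_on A x b" if "b \<in> B" for b
    unfolding p_def using assms that by (rule inner_on_orthonormal_sum)
  have yp: "inner_on A y p = (\<Sum>b\<in>B. cnj (inner_on A x b) * inner_on A y b)" for y
    unfolding p_def inner_on_sum_right inner_on_scale_right ..
  have s: "cnj z * z = complex_of_real ((cmod z)\<^sup>2)" for z
    by (metis complex_norm_square mult.commute)
  have xp: "inner_on A x p = complex_of_real (\<Sum>b\<in>B. (cmod (inner_on A b x))\<^sup>2)"
    unfolding yp s of_real_sum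
    by (intro sum.cong refl) (metis cnj_inner_on complex_mod_cnj)
  have pp: "inner_on A p p = inner_on A x p"
    unfolding yp by (intro sum.cong refl) (simp add: pb)
  have "inner_on A (x - p) (x - p) = inner_on A x x - cnj (inner_on A x p)"
    by (simp add: inner_on_diff_left inner_on_diff_right pp cnj_inner_on)
  then have "complex_of_real (sqnorm_on A (x - p))
      = complex_of_real (sqnorm_on A x - (\<Sum>b\<in>B. (cmod (inner_on A b x))\<^sup>2))"
    by (simp add: xp inner_on_self del: of_real_sum)
  then have "sqnorm_on A (x - p) = sqnorm_on A x - (\<Sum>b\<in>B. (cmod (inner_on A b x))\<^sup>2)"
    by (simp only: of_real_eq_iff)
  then show ?thesis
    using sqnorm_on_nonneg[of A "x - p"] by simp
qed

text \<open>Gram-Schmidt, one vector at a time: fewer than \<open>cfun.dim W\<close> vectors cannot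
  span \<open>W\<close>, so some \<open>w\<close> in \<open>W\<close> has a nonzero component
  orthogonal to \<open>B\<close>, which is then normalised.\<close>

lemma exists_orthonormal_on:
  assumes "finite A" "cfun.subspace W" "W \<subseteq> perm_space A" "m \<le> cfun.dim W"
  shows "\<exists>B. B \<subseteq> W \<and> finite B \<and> card B = m \<and> orthonormal_on A B"
  using assms(4)
proof (induction m)
  case 0
  show ?case by (intro exI[of _ "{}"]) (simp add: orthonormal_on_def)
next
  case (Suc m)
  then obtain B where B: "B \<subseteq> W" "finite B" "card B = m" "orthonormal_on A B"
    by auto
  have "\<not> W \<subseteq> cfun.span B"
    using cfun.dim_le_card[of W B] B Suc.prems by auto
  then obtain w where w: "w \<in> W" "w \<notin> cfun.span B"
    by blast
  define p where "p = (\<Sum>b\<in>B. cfun_scale (inner_on A w b) b)"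
  have p: "p \<in> cfun.span B"
    unfolding p_def by (intro cfun.span_sum cfun.span_scale cfun.span_base)
  have "cfun.span B \<subseteq> W"
    using B assms by (intro cfun.span_minimal)
  then have wpW: "w - p \<in> W"
    using w p assms by (auto intro: cfun.subspace_diff)
  have wp0: "w - p \<noteq> 0"
    using w p by auto
  have pb: "inner_on A p b = inner_on A w b" if "b \<in> B" for b
    unfolding p_def using B(2,4) that by (rule inner_on_orthonormal_sum)
  define r where "r = sqnorm_on A (w - p)"
  have r: "r > 0"
    using sqnorm_on_nonneg[of A "w - p"] sqnorm_on_eq_0_iff[of A "w - p"] wpW wp0 assms
    by (auto simp: r_def)
  define e where "e = cfun_scale (complex_of_real (1 / sqrt r)) (w - p)"
  have eW: "e \<in> W"
    unfolding e_def using assms wpW by (intro cfun.subspace_scale)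
  have eb: "inner_on A e b = 0" if "b \<in> B" for b
    using that by (simp add: e_def inner_on_scale_left inner_on_diff_left pb)
  then have be: "inner_on A b e = 0" if "b \<in> B" for b
    using that by (metis cnj_inner_on complex_cnj_zero)
  have "sqnorm_on A e = 1"
    using r by (simp add: e_def sqnorm_on_scale norm_divide power_divide flip: r_def)
  then have ee: "inner_on A e e = 1"
    by (simp add: inner_on_self)
  then have "e \<notin> B"
    using eb by force
  then show ?case
    using B eW ee eb be by (intro exI[of _ "insert e B"]) (auto simp: orthonormal_on_def)
qed

section \<open>Dimension descent to irreducible subrepresentations\<close>

lemma dim_psubset_perm_space:
  assumes "finite A" "cfun.subspace U" "cfun.subspace W" "W \<subseteq> perm_space A" "U \<subset> W"
  shows "cfun.dim U < cfun.dim W"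
proof -
  obtain B where B: "B \<subseteq> U" "cfun.independent B" "U \<subseteq> cfun.span B" "card B = cfun.dim U"
    using cfun.basis_exists by blast
  obtain w where w: "w \<in> W" "w \<notin> U"
    using assms by blast
  have "cfun.span B \<subseteq> U"
    using B assms by (intro cfun.span_minimal)
  then have "cfun.independent (insert w B)"
    using B w by (intro cfun.independent_insertI) auto
  moreover have "insert w B \<subseteq> W"
    using B w assms by auto
  ultimately obtain C where C: "insert w B \<subseteq> C" "C \<subseteq> W" "cfun.independent C" "W \<subseteq> cfun.span C"
    using cfun.maximal_independent_subset_extend by metis
  \<comment> \<open>The type of all functions may be infinite-dimensional and \<open>card\<close> is
    0 on infinite sets; finiteness comes from independence of \<open>C\<close> inside the span of
    finitely many point vectors.\<close>
  have "finite C"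
    using cfun.independent_span_bound[of "point_vec ` A" C] C assms
    by (auto simp: perm_space_def)
  moreover have "w \<notin> B"
    using w B by auto
  ultimately have "card B < card C"
    using C by (intro psubset_card_mono) auto
  then show ?thesis
    using B C cfun.basis_card_eq_dim[of C W] by simp
qed

text \<open>Either \<open>E\<close> has a proper nonzero subrepresentation, of smaller dimension, or
  \<open>E\<close> is itself irreducible.\<close>

lemma exists_irreducible_subrep:
  assumes "finite \<Omega>" "cfun.group_rep G \<rho> V" "V \<subseteq> perm_space \<Omega>"
    and "cfun.subrep G \<rho> V E" "E \<noteq> {0}"
  shows "\<exists>W. W \<subseteq> E \<and> cfun.irreducible_component G \<rho> V W"
  using assms(4,5)
proof (induction "cfun.dim E" arbitrary: E rule: less_induct)
  case less
  show ?case
  proof (cases "\<exists>U. cfun.subrep G \<rho> E U \<and> U \<noteq> {0} \<and> U \<noteq> E")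
    case True
    then obtain U where U: "cfun.subrep G \<rho> E U" "U \<noteq> {0}" "U \<noteq> E"
      by blast
    then have "cfun.dim U < cfun.dim E"
      using less.prems assms by (intro dim_psubset_perm_space) (auto simp: cfun.subrep_def)
    moreover have "cfun.subrep G \<rho> V U"
      using U less.prems by (auto simp: cfun.subrep_def)
    ultimately show ?thesis
      using less.hyps[of U] U by (auto simp: cfun.subrep_def)
  next
    case False
    have "cfun.group_rep G \<rho> E"
      using less.prems assms(2) unfolding cfun.group_rep_def cfun.subrep_def
      by (meson subset_iff)
    then show ?thesis
      using False less.prems
      by (intro exI[of _ E]) (auto simp: cfun.irreducible_component_def cfun.irreducible_rep_def)
  qed
qed

text \<open>In the product topology this set is a product of closed unit discs over \<open>A\<close>
  and of \<open>{0}\<close> elsewhere, so Tychonoff's theorem applies.\<close>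

lemma compact_perm_space_ball:
  assumes "finite A"
  shows "compact {f \<in> perm_space A. \<forall>x\<in>A. cmod (f x) \<le> 1}"
proof -
  define T where "T x = (if x \<in> A then cball 0 1 else {0 :: complex})" for x
  have "{f \<in> perm_space A. \<forall>x\<in>A. cmod (f x) \<le> 1} = PiE UNIV T"
    by (auto simp: perm_space_eq[OF assms] T_def PiE_def Pi_def dist_norm split: if_splits)
  moreover have "compactin (product_topology (\<lambda>i. euclidean) UNIV) (PiE UNIV T)"
    unfolding compactin_PiE by (auto simp: T_def)
  ultimately show ?thesis
    by (simp add: euclidean_product_topology)
qed

section \<open>Sum-zero functions and centred indicators\<close>

definition sum_zero :: "'w set \<Rightarrow> ('w \<Rightarrow> complex) set" where
  "sum_zero A = {f \<in> perm_space A. (\<Sum>x\<in>A. f x) = 0}"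

lemma subspace_sum_zero: "cfun.subspace (sum_zero A)"
proof -
  have "cfun.subspace (perm_space A)"
    by (simp add: perm_space_def)
  then show ?thesis
    unfolding cfun.subspace_def sum_zero_def
    by (auto simp: sum.distrib cfun_scale_def simp flip: sum_distrib_left)
qed

text \<open>For \<open>D\<close> contained in a finite nonempty \<open>A\<close>, this is the
  orthogonal projection of the indicator of \<open>D\<close> to the sum-zero functions.\<close>

definition centred :: "'w set \<Rightarrow> 'w set \<Rightarrow> 'w \<Rightarrow> complex" where
  "centred A D x = (if x \<in> A then of_bool (x \<in> D) - of_nat (card D) / of_nat (card A) else 0)"

lemma centred_sum_zero:
  assumes "finite A" "A \<noteq> {}" "D \<subseteq> A"
  shows "centred A D \<in> sum_zero A"
  using assms
  by (simp add: sum_zero_def perm_space_eq centred_def sum_subtractf Int_absorb1)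

lemma sqnorm_on_centred:
  assumes "finite A" "A \<noteq> {}" "D \<subseteq> A"
  shows "sqnorm_on A (centred A D) = card D * (1 - card D / card A)"
proof -
  define t where "t = real (card D) / real (card A)"
  have "cmod (centred A D x) = \<bar>of_bool (x \<in> D) - t\<bar>" if "x \<in> A" for x
  proof -
    have "centred A D x = complex_of_real (of_bool (x \<in> D) - t)"
      using that by (simp add: centred_def t_def)
    then show ?thesis
      by (simp only: norm_of_real)
  qed
  then have "sqnorm_on A (centred A D) = (\<Sum>x\<in>A. (of_bool (x \<in> D) - t)\<^sup>2)"
    by (simp add: sqnorm_on_def)
  \<comment> \<open>An indicator equals its own square, so the expanded square is linear in
    it.\<close>
  also have "\<dots> = (\<Sum>x\<in>A. (1 - 2 * t) * of_bool (x \<in> D) + t\<^sup>2)"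
    by (intro sum.cong refl) (simp add: power2_eq_square algebra_simps)
  also have "\<dots> = (1 - 2 * t) * card D + card A * t\<^sup>2"
    using assms by (simp add: sum.distrib Int_absorb1 flip: sum_distrib_left)
  also have "\<dots> = card D * (1 - t)"
    using assms by (simp add: t_def field_simps power2_eq_square)
  finally show ?thesis
    by (simp add: t_def)
qed

section \<open>Unitarity of the permutation representation and the invariant form\<close>

context transitive_action
begin

abbreviation \<rho> where "\<rho> \<equiv> perm_rep E \<phi>"

text \<open>The group moves values along with points: injectivity of \<open>\<phi> g\<close> leaves
  only the term at \<open>x\<close>.\<close>

lemma perm_rep_apply:
  assumes "finite E" "g \<in> carrier G" "x \<in> E"
  shows "\<rho> g f (\<phi> g x) = f x"
proof -
  have "\<rho> g f (\<phi> g x) = (\<Sum>\<omega>\<in>E. if \<omega> = x then f \<omega> else 0)"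
    unfolding perm_rep_def sum_cfun_apply
    using inj_prop[OF assms(2)] assms(3)
    by (intro sum.cong refl) (auto simp: cfun_scale_def point_vec_def inj_on_def)
  then show ?thesis
    using assms by simp
qed

lemma sum_act:
  assumes "g \<in> carrier G"
  shows "(\<Sum>x\<in>E. F x) = (\<Sum>x\<in>E. F (\<phi> g x))"
  using assms inj_prop surj_prop
  by (intro sum.reindex_bij_betw[symmetric]) (auto simp: bij_betw_def)

lemma inner_on_perm_rep:
  assumes "finite E" "g \<in> carrier G"
  shows "inner_on E (\<rho> g u) (\<rho> g v) = inner_on E u v"
  unfolding inner_on_def sum_act[OF assms(2), of "\<lambda>x. \<rho> g u x * cnj (\<rho> g v x)"]
  by (simp add: perm_rep_apply assms)

lemma sqnorm_on_perm_rep: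
  assumes "finite E" "g \<in> carrier G"
  shows "sqnorm_on E (\<rho> g u) = sqnorm_on E u"
  unfolding sqnorm_on_def sum_act[OF assms(2), of "\<lambda>x. (cmod (\<rho> g u x))\<^sup>2"]
  by (simp add: perm_rep_apply assms)

lemma perm_rep_sum_zero:
  assumes "finite E" "g \<in> carrier G" "f \<in> sum_zero E"
  shows "\<rho> g f \<in> sum_zero E"
  using assms group_rep_perm_rep[OF group_action_axioms assms(1)]
  unfolding sum_zero_def cfun.group_rep_def
  by (auto simp: sum_act[OF assms(2), of "\<rho> g f"] perm_rep_apply)

text \<open>The form \<open>Q\<close> attached to \<open>f\<close>; summing over the whole group
  makes it invariant.\<close>

definition coeff_energy where
  "coeff_energy f v = (\<Sum>g\<in>carrier G. (cmod (inner_on E v (\<rho> g f)))\<^sup>2)"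

lemma coeff_energy_scale: "coeff_energy f (cfun_scale c v) = (cmod c)\<^sup>2 * coeff_energy f v"
  by (simp add: coeff_energy_def inner_on_scale_left norm_mult power_mult_distrib sum_distrib_left)

lemma coeff_energy_parallelogram:
  "coeff_energy f (u + v) + coeff_energy f (u - v) = 2 * coeff_energy f u + 2 * coeff_energy f v"
  by (simp add: coeff_energy_def sum_distrib_left inner_on_add_left inner_on_diff_left
      cmod_parallelogram flip: sum.distrib)

text \<open>Left translation by \<open>h\<close> permutes the group, and \<open>\<rho> h\<close>
  preserves the inner product.\<close>

lemma coeff_energy_perm_rep:
  assumes "finite E" "h \<in> carrier G" "f \<in> perm_space E"
  shows "coeff_energy f (\<rho> h v) = coeff_energy f v"
proof -
  interpret group G
    using group_hom group_hom.axioms(1) by auto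
  have "bij_betw (\<lambda>g. h \<otimes> g) (carrier G) (carrier G)"
    using assms(2) by (intro bij_betwI[where g = "\<lambda>g. inv h \<otimes> g"])
      (auto simp flip: m_assoc)
  from sum.reindex_bij_betw[OF this]
  have "coeff_energy f (\<rho> h v) = (\<Sum>g\<in>carrier G. (cmod (inner_on E (\<rho> h v) (\<rho> (h \<otimes> g) f)))\<^sup>2)"
    unfolding coeff_energy_def by (rule sym)
  also have "\<dots> = coeff_energy f v"
    unfolding coeff_energy_def
  proof (intro sum.cong refl)
    fix g assume "g \<in> carrier G"
    then have "\<rho> (h \<otimes> g) f = \<rho> h (\<rho> g f)"
      using group_rep_perm_rep[OF group_action_axioms assms(1)] assms
      unfolding cfun.group_rep_def by auto
    then show "(cmod (inner_on E (\<rho> h v) (\<rho> (h \<otimes> g) f)))\<^sup>2 = (cmod (inner_on E v (\<rho> g f)))\<^sup>2"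
      using inner_on_perm_rep[OF assms(1,2)] by simp
  qed
  finally show ?thesis .
qed

text \<open>By transitivity a fixed vector is constant on \<open>E\<close>, and a constant with sum
  zero vanishes.\<close>

lemma not_trivial_sum_zero:
  assumes "finite E" "W \<subseteq> sum_zero E" "W \<noteq> {0}" "cfun.subspace W"
  shows "\<not> cfun.trivial_rep G \<rho> W"
proof
  assume triv: "cfun.trivial_rep G \<rho> W"
  obtain w where w: "w \<in> W" "w \<noteq> 0"
    using assms cfun.subspace_0 by blast
  have wE: "w \<in> perm_space E" "(\<Sum>x\<in>E. w x) = 0"
    using w assms by (auto simp: sum_zero_def)
  have const: "w x = w y" if xy: "x \<in> E" "y \<in> E" for x y
  proof -
    obtain g where g: "g \<in> carrier G" "\<phi> g x = y"
      using unique_orbit[OF xy] by blast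
    have "\<rho> g w = w"
      using triv g w by (auto simp: cfun.trivial_rep_def)
    then show ?thesis
      using perm_rep_apply[OF assms(1) g(1) xy(1), of w] g by simp
  qed
  obtain x where x: "w x \<noteq> 0"
    using w by (auto simp: fun_eq_iff)
  then have xE: "x \<in> E"
    using wE assms by (auto simp: perm_space_eq)
  have "(\<Sum>y\<in>E. w y) = of_nat (card E) * w x"
    using const[OF _ xE] by simp
  then show False
    using wE x xE assms by auto
qed

text \<open>A continuous function attains its maximum on the compact unit sphere of the sum-zero
  functions; the bound extends to all \<open>v\<close> because both sides scale by the square of the
  modulus.\<close>

lemma exists_max_coeff_energy:
  assumes "finite E" "sum_zero E \<noteq> {0}"
  shows "\<exists>u\<in>sum_zero E. sqnorm_on E u = 1 \<and>
           (\<forall>v\<in>sum_zero E. coeff_energy f v \<le> coeff_energy f u * sqnorm_on E v)"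
proof -
  let ?K = "{f \<in> perm_space E. \<forall>x\<in>E. cmod (f x) \<le> 1}"
  let ?U = "{v \<in> sum_zero E. sqnorm_on E v = 1}"
  have le1: "cmod (v x) \<le> 1" if "sqnorm_on E v = 1" "x \<in> E" for v x
  proof -
    have "(cmod (v x))\<^sup>2 \<le> sqnorm_on E v"
      unfolding sqnorm_on_def using that assms by (intro member_le_sum) auto
    then show ?thesis
      using that by (simp add: power2_le_iff_abs_le abs_square_le_1)
  qed
  have c1: "continuous_on UNIV (\<lambda>v. sqnorm_on E v)"
    unfolding sqnorm_on_def by (intro continuous_intros continuous_on_product_coordinates)
  have c2: "continuous_on UNIV (\<lambda>v. \<Sum>x\<in>E. v x :: complex)"
    using continuous_on_sum[of E UNIV "\<lambda>x v. v x"] by simp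
  have c3: "continuous_on UNIV (coeff_energy f)"
    unfolding coeff_energy_def inner_on_def
    by (intro continuous_intros continuous_on_product_coordinates)
  \<comment> \<open>Coordinates of unit vectors have modulus at most 1, so the sphere is cut out of
    the compact \<open>?K\<close> by closed conditions.\<close>
  have "?U = ?K \<inter> ({v. sqnorm_on E v = 1} \<inter> {v. (\<Sum>x\<in>E. v x) = 0})"
    by (auto simp: sum_zero_def le1)
  moreover have "closed {v. sqnorm_on E v = 1}"
    by (rule closed_Collect_eq[OF c1 continuous_on_const])
  moreover have "closed {v. (\<Sum>x\<in>E. v x :: complex) = 0}"
    by (rule closed_Collect_eq[OF c2 continuous_on_const])
  ultimately have comp: "compact ?U"
    using compact_Int_closed[OF compact_perm_space_ball[OF assms(1)] closed_Int] by simp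
  have norm: "\<exists>c>0. cfun_scale (complex_of_real c) v \<in> ?U \<and> c\<^sup>2 * sqnorm_on E v = 1"
    if v: "v \<in> sum_zero E" "v \<noteq> 0" for v
  proof -
    have pos: "sqnorm_on E v > 0"
      using sqnorm_on_nonneg[of E v] sqnorm_on_eq_0_iff[OF assms(1), of v] v
      by (auto simp: sum_zero_def)
    show ?thesis
      using pos v cfun.subspace_scale[OF subspace_sum_zero]
      by (intro exI[of _ "1 / sqrt (sqnorm_on E v)"])
        (auto simp: sqnorm_on_scale norm_divide power_divide)
  qed
  have "?U \<noteq> {}"
    using norm assms cfun.subspace_0[OF subspace_sum_zero] by blast
  from continuous_attains_sup[OF comp this, of "coeff_energy f"] c3
  obtain u where u: "u \<in> ?U" "\<forall>v\<in>?U. coeff_energy f v \<le> coeff_energy f u"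
    using continuous_on_subset by blast
  have "coeff_energy f v \<le> coeff_energy f u * sqnorm_on E v" if v: "v \<in> sum_zero E" for v
  proof (cases "v = 0")
    case True
    then show ?thesis
      by (simp add: coeff_energy_def sqnorm_on_def inner_on_def)
  next
    case False
    then obtain c where c: "c > 0" "cfun_scale (complex_of_real c) v \<in> ?U" "c\<^sup>2 * sqnorm_on E v = 1"
      using norm v by blast
    then have "c\<^sup>2 * coeff_energy f v \<le> coeff_energy f u * (c\<^sup>2 * sqnorm_on E v)"
      using u(2) coeff_energy_scale[of f "complex_of_real c" v] by fastforce
    then show ?thesis
      using c(1) by (simp add: mult.left_commute)
  qed
  then show ?thesis
    using u by blast
qed

text \<open>The maximal ratio \<open>l\<close> is attained on a whole irreducible component, whose
  dimension is at least \<open>d\<close>; averaging over an orthonormal basis there bounds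
  \<open>l\<close>.\<close>

lemma coeff_energy_le:
  assumes fin: "finite (carrier G)" "finite E" and "d > 0"
    and deg: "\<And>W. cfun.irreducible_component G \<rho> (perm_space E) W \<Longrightarrow>
           \<not> cfun.trivial_rep G \<rho> W \<Longrightarrow> real (cfun.dim W) \<ge> d"
    and f: "f \<in> perm_space E" and v: "v \<in> sum_zero E"
  shows "coeff_energy f v \<le> real (order G) / d * sqnorm_on E f * sqnorm_on E v"
proof (cases "sum_zero E = {0}")
  \<comment> \<open>No unit vector exists here, for instance when \<open>E\<close> is a single
    point; \<open>v\<close> is 0 and so are both sides.\<close>
  case True
  with v show ?thesis
    by (simp add: coeff_energy_def sqnorm_on_def inner_on_def)
next
  case False
  obtain u where u: "u \<in> sum_zero E" "sqnorm_on E u = 1"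
      "\<And>v. v \<in> sum_zero E \<Longrightarrow> coeff_energy f v \<le> coeff_energy f u * sqnorm_on E v"
    using exists_max_coeff_energy[OF fin(2) False] by blast
  define l where "l = coeff_energy f u"
  define M where "M = {v \<in> sum_zero E. coeff_energy f v = l * sqnorm_on E v}"
  have "cfun.subspace M"
    unfolding cfun.subspace_def
  proof (intro conjI ballI allI)
    show "0 \<in> M"
      using cfun.subspace_0[OF subspace_sum_zero]
      by (simp add: M_def coeff_energy_def sqnorm_on_def inner_on_def)
  next
    fix x c assume "x \<in> M"
    then show "cfun_scale c x \<in> M"
      using cfun.subspace_scale[OF subspace_sum_zero]
      by (auto simp: M_def coeff_energy_scale sqnorm_on_scale)
  next
    fix x y assume xy: "x \<in> M" "y \<in> M"
    then have mem: "x + y \<in> sum_zero E" "x - y \<in> sum_zero E"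
      using cfun.subspace_add[OF subspace_sum_zero] cfun.subspace_diff[OF subspace_sum_zero]
      by (auto simp: M_def)
    have "coeff_energy f (x + y) + coeff_energy f (x - y)
        = l * (sqnorm_on E (x + y) + sqnorm_on E (x - y))"
      using xy unfolding coeff_energy_parallelogram sqnorm_on_parallelogram
      by (simp add: M_def algebra_simps)
    \<comment> \<open>By maximality neither \<open>x + y\<close> nor \<open>x - y\<close> exceeds
      its bound; since the bounds add up to equality, each one is attained.\<close>
    then have "coeff_energy f (x + y) = l * sqnorm_on E (x + y)"
      using u(3)[OF mem(1)] u(3)[OF mem(2)] by (simp add: l_def algebra_simps)
    then show "x + y \<in> M"
      using mem by (simp add: M_def)
  qed
  then have "cfun.subrep G \<rho> (perm_space E) M"
    using fin f by (auto simp: cfun.subrep_def M_def coeff_energy_perm_rep sqnorm_on_perm_rep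
        perm_rep_sum_zero) (simp add: sum_zero_def)
  moreover have "u \<in> M" "u \<noteq> 0"
    using u by (auto simp: M_def l_def sqnorm_on_def)
  then have "M \<noteq> {0}"
    by blast
  ultimately obtain W where W: "W \<subseteq> M" "cfun.irreducible_component G \<rho> (perm_space E) W"
    using exists_irreducible_subrep[OF fin(2) group_rep_perm_rep[OF group_action_axioms fin(2)]]
    by blast
  have W': "cfun.subspace W" "W \<subseteq> perm_space E" "W \<noteq> {0}" "W \<subseteq> sum_zero E"
    using W by (auto simp: cfun.irreducible_component_def cfun.subrep_def cfun.irreducible_rep_def M_def)
  have dW: "d \<le> real (cfun.dim W)"
    using deg[OF W(2)] not_trivial_sum_zero[OF fin(2)] W' by blast
  obtain B where B: "B \<subseteq> W" "finite B" "card B = cfun.dim W" "orthonormal_on E B"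
    using exists_orthonormal_on[OF fin(2) W'(1,2) order_refl] by blast
  have nb: "sqnorm_on E b = 1" if "b \<in> B" for b
    using B(4) that inner_on_self[of E b] by (auto simp: orthonormal_on_def)
  have "l * real (cfun.dim W) = (\<Sum>b\<in>B. coeff_energy f b)"
    using B(1,3) W(1) nb by (simp add: M_def subset_iff)
  also have "\<dots> = (\<Sum>g\<in>carrier G. \<Sum>b\<in>B. (cmod (inner_on E b (\<rho> g f)))\<^sup>2)"
    unfolding coeff_energy_def by (rule sum.swap)
  also have "\<dots> \<le> (\<Sum>g\<in>carrier G. sqnorm_on E (\<rho> g f))"
    by (intro sum_mono bessel_on B)
  also have "\<dots> = real (order G) * sqnorm_on E f"
    by (simp add: sqnorm_on_perm_rep fin order_def)
  finally have *: "l * real (cfun.dim W) \<le> real (order G) * sqnorm_on E f" .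
  have "l \<ge> 0"
    by (simp add: l_def coeff_energy_def sum_nonneg)
  then have "l * d \<le> real (order G) * sqnorm_on E f"
    using mult_left_mono[OF dW] * by force
  then have "l \<le> real (order G) / d * sqnorm_on E f"
    using \<open>d > 0\<close> by (simp add: field_simps)
  then show ?thesis
    using u(3)[OF v] mult_right_mono[OF _ sqnorm_on_nonneg[of E v]] by (force simp: l_def)
qed

lemma inner_on_centred:
  assumes "finite E" "E \<noteq> {}" "D \<subseteq> E" "D' \<subseteq> E" "g \<in> carrier G"
    and disj: "\<And>x. x \<in> D \<Longrightarrow> \<phi> g x \<notin> D'"
  shows "inner_on E (centred E D') (\<rho> g (centred E D)) = - (of_nat (card D * card D') / of_nat (card E))"
proof -
  define s t where "s = complex_of_nat (card D) / of_nat (card E)"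
    and "t = complex_of_nat (card D') / of_nat (card E)"
  have act: "\<phi> g x \<in> E" if "x \<in> E" for x
    using element_image[OF assms(5) that refl] .
  have "inner_on E (centred E D') (\<rho> g (centred E D)) = (\<Sum>x\<in>E. centred E D' (\<phi> g x) * centred E D x)"
    unfolding inner_on_def sum_act[OF assms(5), of "\<lambda>x. centred E D' x * cnj (\<rho> g (centred E D) x)"]
    using assms by (intro sum.cong refl) (auto simp: perm_rep_apply centred_def)
  also have "\<dots> = (\<Sum>x\<in>E. - t * of_bool (x \<in> D) - s * centred E D' (\<phi> g x))"
    using act disj
    by (intro sum.cong refl) (auto simp: centred_def s_def t_def algebra_simps)
  also have "\<dots> = - t * of_nat (card D) - s * (\<Sum>x\<in>E. centred E D' x)"
    using assms(1,3) sum_act[OF assms(5), of "centred E D'"]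
    by (simp add: sum_subtractf sum_negf Int_absorb1 flip: sum_distrib_left)
  also have "(\<Sum>x\<in>E. centred E D' x) = 0"
    using centred_sum_zero[OF assms(1,2,4)] by (simp add: sum_zero_def)
  finally show ?thesis
    by (simp add: t_def)
qed

end

theorem corollary1p1:
  fixes G :: "('g, 'm) monoid_scheme"
    and \<Omega> \<Delta>1 \<Delta>2 :: "'w set"
    and \<phi> :: "'g \<Rightarrow> 'w \<Rightarrow> 'w"
    and S :: "'g set"
    and d\<^sub>H :: real
  assumes "finite (carrier G)"
    and "finite \<Omega>" and "\<Omega> \<noteq> {}"
    and "transitive_action G \<Omega> \<phi>"
    and "d\<^sub>H > 0"
    and "\<And>W. cfun.irreducible_component G (perm_rep \<Omega> \<phi>) (perm_space \<Omega>) W \<Longrightarrow>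
           \<not> cfun.trivial_rep G (perm_rep \<Omega> \<phi>) W \<Longrightarrow> real (cfun.dim W) \<ge> d\<^sub>H"
    and "S \<subseteq> carrier G" and "\<Delta>1 \<subseteq> \<Omega>" and "\<Delta>2 \<subseteq> \<Omega>"
    and "real (card S) * real (card \<Delta>1) * real (card \<Delta>2)
           \<ge> (real (card \<Omega>))\<^sup>2 * real (order G) / d\<^sub>H"
  shows "\<exists>g\<in>S. \<exists>\<omega>1\<in>\<Delta>1. \<exists>\<omega>2\<in>\<Delta>2. \<phi> g \<omega>1 = \<omega>2"
proof (rule ccontr)
  assume no: "\<not> ?thesis"
  interpret transitive_action G \<Omega> \<phi> by fact
  interpret group G
    using group_hom group_hom.axioms(1) by auto
  define n k s a b where "n = real (card \<Omega>)" and "k = real (order G) / d\<^sub>H"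
    and "s = real (card S)" and "a = real (card \<Delta>1)" and "b = real (card \<Delta>2)"
  have n: "n > 0"
    using assms by (simp add: n_def card_gt_0_iff)
  have k: "k > 0"
    using assms by (simp add: k_def order_gt_0_iff_finite)
  have hyp: "n\<^sup>2 * k \<le> s * a * b"
    using assms(10) by (simp add: n_def k_def s_def a_def b_def)
  have nonneg: "s \<ge> 0" "a \<ge> 0" "b \<ge> 0"
    by (simp_all add: s_def a_def b_def)
  have "s * a * b > 0"
    using hyp n k by (smt (verit) mult_pos_pos zero_less_power)
  then have pos: "s > 0" "a > 0" "b > 0"
    using nonneg by (auto simp: zero_less_mult_iff order.strict_iff_order)
  have le: "a \<le> n" "b \<le> n"
    using assms by (auto simp: a_def b_def n_def card_mono)
  have z: "centred \<Omega> \<Delta>1 \<in> perm_space \<Omega>" "centred \<Omega> \<Delta>2 \<in> sum_zero \<Omega>"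
    using centred_sum_zero assms by (auto simp: sum_zero_def)
  have "s * (a * b / n)\<^sup>2 = (\<Sum>g\<in>S. (cmod (inner_on \<Omega> (centred \<Omega> \<Delta>2) (\<rho> g (centred \<Omega> \<Delta>1))))\<^sup>2)"
  proof -
    have "(cmod (inner_on \<Omega> (centred \<Omega> \<Delta>2) (\<rho> g (centred \<Omega> \<Delta>1))))\<^sup>2 = (a * b / n)\<^sup>2" if "g \<in> S" for g
    proof -
      have "inner_on \<Omega> (centred \<Omega> \<Delta>2) (\<rho> g (centred \<Omega> \<Delta>1)) = - complex_of_real (a * b / n)"
        using that assms no by (subst inner_on_centred) (auto simp: a_def b_def n_def)
      then show ?thesis
        by (simp only: norm_minus_cancel norm_of_real power2_abs)
    qed
    then show ?thesis
      by (simp add: s_def)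
  qed
  also have "\<dots> \<le> coeff_energy (centred \<Omega> \<Delta>1) (centred \<Omega> \<Delta>2)"
    unfolding coeff_energy_def using assms by (intro sum_mono2) auto
  also have "\<dots> \<le> k * sqnorm_on \<Omega> (centred \<Omega> \<Delta>1) * sqnorm_on \<Omega> (centred \<Omega> \<Delta>2)"
    unfolding k_def using assms z by (intro coeff_energy_le) auto
  also have "\<dots> = k * (a * (1 - a / n)) * (b * (1 - b / n))"
    using assms by (simp add: sqnorm_on_centred a_def b_def n_def)
  finally have "s * (a * b / n)\<^sup>2 \<le> k * (a * (1 - a / n)) * (b * (1 - b / n))" .
  then have "s * a * b * (a * b) \<le> n\<^sup>2 * k * (a * b) * ((1 - a / n) * (1 - b / n))"
    using n by (simp add: power2_eq_square divide_simps) (simp add: algebra_simps)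
  then have "s * a * b * (a * b) \<le> (n\<^sup>2 * k * ((1 - a / n) * (1 - b / n))) * (a * b)"
    by (simp add: mult_ac)
  then have "s * a * b \<le> n\<^sup>2 * k * ((1 - a / n) * (1 - b / n))"
    using pos by (subst (asm) mult_le_cancel_right_pos) simp_all
  also have "\<dots> < n\<^sup>2 * k * 1"
  proof -
    have "(1 - a / n) * (1 - b / n) \<le> 1 - a / n"
      using pos le n by (intro mult_left_le) (auto simp: field_simps)
    also have "\<dots> < 1"
      using pos n by simp
    finally show ?thesis
      using n k by (intro mult_strict_left_mono) auto
  qed
  finally show False
    using hyp by simp
qed

end
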